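(* For every integer $r \ge 1$, the following four identities hold: $$B_{r+1}=\frac{(-1)^r\,(r+1)\,2^r}{2^{r+1}-1}\sum_{k=1}^{r}\frac{S(r,k)}{k+1}(-1)^{k}\,2^{-2k}\,\frac{(2k-1)!}{(k-1)!},$$ $$B_{r+1}=\frac{(-1)^r(r+1)}{2^r(2^{r+1}-1)}\binom{2r}{r-1}\sum_{l=1}^{r}(-1)^l A(r,r-l)\,\frac{\binom{r-1}{l-1}}{\binom{2r}{2l-1}},$$ $$(-1)^{r-1}B_{r}=\sum_{k=1}^{r}(-1)^{k}\,\frac{S(r,k)}{k+1}\,(k-1)!,$$ and $$(-1)^{r-1}B_{r}=\sum_{l=1}^{r}A(r,r-l)\,\frac{(-1)^l}{l\,\binom{r+1}{l}}.$$ Here $B_n$ is the $n$-th Bernoulli number, $S(r,k)$ is the Stirling number of the second kind, and $A(r,j)$ is the Eulerian number.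
   Context: The Bernoulli numbers $B_n$ are defined by $\frac{t}{e^t-1}=\sum_{n\ge 0}B_n\frac{t^n}{n!}$, so $B_1=-\tfrac12$; equivalently $\zeta(-r)=(-1)^r\frac{B_{r+1}}{r+1}$ for integers $r\ge 0$, where $\zeta$ is the Riemann zeta function. $S(r,k)$, the Stirling number of the second kind, is the number of partitions of an $r$-element set into $k$ nonempty blocks. $A(r,j)$, for $0\le j\le r-1$, denotes the Eulerian number (often written with angle brackets as $\left\langle {r \atop j}\right\rangle$), i.e. the number of permutations of $\{1,\dots,r\}$ with exactly $j$ descents; equivalently $\sum_{n\ge 1} n^r z^n=\frac{1}{(1-z)^{r+1}}\sum_{j=0}^{r-1}A(r,j)\,z^{r-j}$ for $|z|<1$. *)

theory Defs
  imports
    "HOL-Computational_Algebra.Formal_Power_Series"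
    "HOL-Combinatorics.Permutations"
    "HOL-Combinatorics.Stirling"
begin

text \<open>
  Exponential generating function \<open>t / (e\<^sup>t - 1)\<close>, hence the convention \<open>B\<^sub>1 = -1/2\<close>. The
  division is that of formal power series, which cancels the common factor \<open>t\<close>.
\<close>
definition bernoulli :: "nat \<Rightarrow> real" where
  "bernoulli n = fact n * fps_nth (fps_X / (fps_exp 1 - 1)) n"

lemma bernoulli_fps:
  "Abs_fps (\<lambda>n. bernoulli n / fact n) * (fps_exp 1 - 1) = fps_X"
proof -
  let ?e = "fps_exp (1::real) - 1"
  have nth: "fps_nth ?e 0 = 0" "fps_nth ?e 1 = 1"
    by simp_all
  hence "?e \<noteq> 0"
    by (metis fps_zero_nth zero_neq_one)
  moreover from nth have sd: "subdegree ?e = 1"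
    by (intro subdegreeI) auto
  ultimately have "fps_X / ?e * ?e = fps_X"
    by (intro dvd_div_mult_self) (simp add: fps_dvd_iff)
  moreover have "Abs_fps (\<lambda>n. bernoulli n / fact n) = fps_X / ?e"
    by (rule fps_ext) (simp add: bernoulli_def)
  ultimately show ?thesis
    by simp
qed

definition descents :: "nat \<Rightarrow> (nat \<Rightarrow> nat) \<Rightarrow> nat set" where
  "descents r p = {i \<in> {1..<r}. p i > p (i + 1)}"

definition eulerian :: "nat \<Rightarrow> nat \<Rightarrow> nat" where
  "eulerian r j = card {p. p permutes {1..r} \<and> card (descents r p) = j}"

end

theory Submission
  imports Defs "HOL-Combinatorics.Multiset_Permutations"
begin

text \<open>
  Since \<open>\<Sum>\<^sub>r k! S(r,k) t\<^sup>r/r! = (e\<^sup>t - 1)\<^sup>k\<close>, the exponential generating function in \<open>r\<close> of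
  \<open>\<Sum>\<^sub>k (-1)\<^sup>k k! S(r,k) c\<^sub>k\<close> is \<open>C(1 - e\<^sup>t)\<close> with \<open>C(u) = \<Sum> c\<^sub>k u\<^sup>k\<close>. The two Stirling sums are the
  cases \<open>c\<^sub>k = 1/(k(k+1))\<close>, which gives \<open>1 - t e\<^sup>t/(e\<^sup>t - 1)\<close>, and
  \<open>c\<^sub>k = Cat\<^sub>k/4\<^sup>k\<close>, which gives \<open>2/(1 + e\<^sup>t\<^sup>/\<^sup>2)\<close>; both are expressed by the generating function of
  the Bernoulli numbers. The Eulerian sums arise from the Stirling sums by replacing, under the
  linear functional \<open>x\<^sup>k \<mapsto> (-1)\<^sup>k c\<^sub>k\<close>, the polynomial \<open>\<Sum> k! S(r,k) x\<^sup>k\<close> by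
  \<open>\<Sum> A(r,r-l) x\<^sup>l (1+x)\<^sup>r\<^sup>-\<^sup>l\<close>; the functionals are Beta integrals.
\<close>

subsection \<open>Descents and Eulerian numbers\<close>

fun des :: "nat list \<Rightarrow> nat" where
  "des (x # y # xs) = of_bool (x > y) + des (y # xs)"
| "des _ = 0"

lemma des_append:
  "des (xs @ ys) = des xs + des ys + of_bool (xs \<noteq> [] \<and> ys \<noteq> [] \<and> last xs > hd ys)"
proof (induction xs rule: des.induct)
  case (1 x y xs)
  then show ?case by simp
next
  case "2_1"
  then show ?case by simp
next
  case ("2_2" v)
  then show ?case by (cases ys) auto
qed

text \<open>The index form links the recursive count to \<open>descents\<close> and later names the
  insertion slots. Appending an entry can add only the index \<open>length xs\<close>.\<close>

lemma des_conv_card: "des xs = card {i \<in> {0<..<length xs}. xs ! (i - 1) > xs ! i}"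
proof (induction xs rule: rev_induct)
  case Nil
  then show ?case by simp
next
  case (snoc x xs)
  let ?D = "\<lambda>xs :: nat list. {i \<in> {0<..<length xs}. xs ! (i - 1) > xs ! i}"
  have "?D (xs @ [x]) = ?D xs \<union> (if xs \<noteq> [] \<and> last xs > x then {length xs} else {})"
    by (cases "xs = []") (auto simp: nth_append last_conv_nth less_Suc_eq split: if_splits)
  moreover have "length xs \<notin> ?D xs" "finite (?D xs)"
    by auto
  ultimately show ?case
    using snoc.IH by (simp add: des_append)
qed

lemma des_le_length: "des xs \<le> length xs - 1"
proof -
  have "des xs \<le> card {0<..<length xs}"
    unfolding des_conv_card by (rule card_mono) auto
  then show ?thesis by simp
qed

text \<open>An inserted maximum \<open>M\<close> is followed by a descent unless it comes last, and
  never preceded by one. It separates the neighbours at \<open>i - 1\<close> and \<open>i\<close>,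
  so a descent there is merely replaced.\<close>

lemma des_insert:
  assumes "\<forall>x\<in>set xs. x < M" "i \<le> length xs"
  shows "des (take i xs @ M # drop i xs) =
    des xs + of_bool (i < length xs \<and> \<not> (0 < i \<and> xs ! (i - 1) > xs ! i))"
proof (cases "i < length xs")
  case True
  have d: "drop i xs = xs ! i # drop (Suc i) xs"
    using True by (simp add: Cons_nth_drop_Suc)
  have lt: "M > xs ! i"
    using assms True by auto
  have "des (M # drop i xs) = Suc (des (drop i xs))"
    unfolding d using lt by simp
  moreover have lst: "take i xs \<noteq> [] \<Longrightarrow> last (take i xs) = xs ! (i - 1)"
    using True by (auto simp: last_conv_nth min_def)
  moreover have "\<not> M < last (take i xs)" if "take i xs \<noteq> []"
    using assms that by (metis last_in_set in_set_takeD not_less_iff_gr_or_eq)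
  ultimately have "des (take i xs @ M # drop i xs) = des (take i xs) + Suc (des (drop i xs))"
    by (auto simp: des_append)
  moreover have "des xs = des (take i xs) + des (drop i xs)
      + of_bool (0 < i \<and> xs ! (i - 1) > xs ! i)"
  proof (cases "i = 0")
    case False
    then have "take i xs \<noteq> []" "drop i xs \<noteq> []" "hd (drop i xs) = xs ! i"
      using True by (auto simp: hd_drop_conv_nth)
    with False des_append [of "take i xs" "drop i xs"] lst show ?thesis
      by (simp only: append_take_drop_id) simp
  qed simp
  ultimately show ?thesis
    using True by auto
next
  case False
  then have i: "i = length xs"
    using assms by simp
  have "\<not> M < last xs" if "xs \<noteq> []"
    using assms that by (metis last_in_set not_less_iff_gr_or_eq)
  then show ?thesis
    using i by (auto simp: des_append)
qed

text \<open>The slots that preserve the count are those inside an existing descent and the one at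
  the end; all others add one. This is the Eulerian recurrence in weighted form.\<close>

lemma sum_des_insert:
  fixes f :: "nat \<Rightarrow> real"
  assumes "\<forall>x\<in>set xs. x < M"
  shows "(\<Sum>i\<le>length xs. f (des (take i xs @ M # drop i xs))) =
    real (des xs + 1) * f (des xs) + real (length xs - des xs) * f (des xs + 1)"
proof -
  let ?D = "{i \<in> {0<..<length xs}. xs ! (i - 1) > xs ! i}"
  let ?S = "insert (length xs) ?D"
  have card: "card ?S = des xs + 1"
    by (simp add: des_conv_card)
  have sub: "?S \<subseteq> {..length xs}"
    by auto
  have "(\<Sum>i\<le>length xs. f (des (take i xs @ M # drop i xs))) =
      (\<Sum>i\<in>?S. f (des (take i xs @ M # drop i xs)))
      + (\<Sum>i\<in>{..length xs} - ?S. f (des (take i xs @ M # drop i xs)))"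
    by (subst sum.subset_diff [OF sub]) (simp_all add: add.commute)
  also have "(\<Sum>i\<in>?S. f (des (take i xs @ M # drop i xs))) = (\<Sum>i\<in>?S. f (des xs))"
  proof (rule sum.cong [OF refl])
    fix i
    assume "i \<in> ?S"
    then show "f (des (take i xs @ M # drop i xs)) = f (des xs)"
      using des_insert [OF assms, of i] by auto
  qed
  also have "(\<Sum>i\<in>{..length xs} - ?S. f (des (take i xs @ M # drop i xs)))
      = (\<Sum>i\<in>{..length xs} - ?S. f (des xs + 1))"
  proof (rule sum.cong [OF refl])
    fix i
    assume "i \<in> {..length xs} - ?S"
    then show "f (des (take i xs @ M # drop i xs)) = f (des xs + 1)"
      using des_insert [OF assms, of i] by auto
  qed
  finally show ?thesis
    using card card_Diff_subset [of ?S "{..length xs}"] sub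
    by (simp add: finite_subset [OF sub])
qed

text \<open>Pairs of a list and a slot correspond to the enlarged lists; the inverse deletes
  \<open>M\<close> and reads off its position.\<close>

lemma sum_permutations_of_set_insert:
  fixes f :: "'a list \<Rightarrow> real"
  assumes "finite A" "M \<notin> A"
  shows "sum f (permutations_of_set (insert M A)) =
    (\<Sum>xs\<in>permutations_of_set A. \<Sum>i\<le>length xs. f (take i xs @ M # drop i xs))"
proof -
  have "(\<Sum>xs\<in>permutations_of_set A. \<Sum>i\<le>length xs. f (take i xs @ M # drop i xs)) =
      (\<Sum>(xs, i)\<in>Sigma (permutations_of_set A) (\<lambda>xs. {..length xs}).
        f (take i xs @ M # drop i xs))"
    by (rule sum.Sigma) auto
  also have "\<dots> = sum f (permutations_of_set (insert M A))"
  proof (rule sum.reindex_bij_witness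
      [where i = "\<lambda>ys. (remove1 M ys, length (takeWhile (\<lambda>y. y \<noteq> M) ys))"
         and j = "\<lambda>(xs, i). take i xs @ M # drop i xs"])
    fix a
    assume "a \<in> Sigma (permutations_of_set A) (\<lambda>xs. {..length xs})"
    then obtain xs i where a: "a = (xs, i)" "set xs = A" "distinct xs" "i \<le> length xs"
      by (auto simp: permutations_of_set_def)
    have nt: "M \<notin> set (take i xs)"
      using a assms by (auto dest: in_set_takeD)
    have "takeWhile (\<lambda>y. y \<noteq> M) (take i xs @ M # drop i xs) = take i xs"
      using nt by (subst takeWhile_append2) auto
    then show "(remove1 M (case a of (xs, i) \<Rightarrow> take i xs @ M # drop i xs),
        length (takeWhile (\<lambda>y. y \<noteq> M) (case a of (xs, i) \<Rightarrow> take i xs @ M # drop i xs))) = a"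
      using nt a by (simp add: remove1_append)
    have "set (take i xs) \<union> set (drop i xs) = set xs"
      by (metis append_take_drop_id set_append)
    moreover have "set (take i xs) \<inter> set (drop i xs) = {}"
      using a by (metis append_take_drop_id distinct_append)
    ultimately show "(case a of (xs, i) \<Rightarrow> take i xs @ M # drop i xs) \<in> permutations_of_set (insert M A)"
      using a assms by (auto simp: permutations_of_set_def)
  next
    fix ys
    assume "ys \<in> permutations_of_set (insert M A)"
    then have ys: "set ys = insert M A" "distinct ys"
      by (auto simp: permutations_of_set_def)
    then obtain us vs where uv: "ys = us @ M # vs"
      by (metis insertI1 split_list)
    with ys have nt: "M \<notin> set us" "M \<notin> set vs"
      by auto
    have tw: "takeWhile (\<lambda>y. y \<noteq> M) ys = us"
      unfolding uv using nt by (subst takeWhile_append2) auto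
    have rm: "remove1 M ys = us @ vs"
      unfolding uv using nt by (simp add: remove1_append)
    show "(case (remove1 M ys, length (takeWhile (\<lambda>y. y \<noteq> M) ys)) of
        (xs, i) \<Rightarrow> take i xs @ M # drop i xs) = ys"
      by (simp only: tw rm) (simp add: uv)
    have "set us \<union> set vs = A"
      using ys nt assms(2) unfolding uv by auto
    then show "(remove1 M ys, length (takeWhile (\<lambda>y. y \<noteq> M) ys))
        \<in> Sigma (permutations_of_set A) (\<lambda>xs. {..length xs})"
      unfolding tw rm using ys(2) by (auto simp: permutations_of_set_def uv)
  qed auto
  finally show ?thesis by simp
qed

text \<open>Read \<open>b l m\<close> as a linear functional at x^l (1+x)^m; the hypothesis is 1+x =
  1 + x times such a term. Both sides evaluate the same polynomial F, which passes from r to r+1 by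
  F -> x d/dx ((1+x) F); the induction moves this operator onto \<open>b\<close>, hence the
  generalisation over \<open>b\<close>.\<close>

lemma sum_permutations_des_conv_Stirling:
  fixes b :: "nat \<Rightarrow> nat \<Rightarrow> real"
  assumes "\<And>l m. l \<ge> 1 \<Longrightarrow> b l (Suc m) = b l m + b (Suc l) m"
  shows "(\<Sum>xs\<in>permutations_of_set {1..r}. b (r - des xs) (des xs)) =
    (\<Sum>k\<le>r. fact k * real (Stirling r k) * b k 0)"
  using assms
proof (induction r arbitrary: b)
  case 0
  then show ?case by simp
next
  case (Suc r)
  \<comment> \<open>Inserting \<open>Suc r\<close> keeps the number of descents \<open>d\<close> at \<open>d + 1\<close> positions and raises it at \<open>r - d\<close>
    positions; \<open>b'\<close> collects these contributions and again satisfies the recurrence.\<close>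
  define b' where "b' l m = real (m + 1) * b (Suc l) m + real l * b l (Suc m)" for l m
  have rec: "b' l (Suc m) = b' l m + b' (Suc l) m" if "l \<ge> 1" for l m
    using that by (simp add: b'_def Suc.prems algebra_simps)
  have "(\<Sum>xs\<in>permutations_of_set {1..Suc r}. b (Suc r - des xs) (des xs)) =
      (\<Sum>xs\<in>permutations_of_set {1..r}. \<Sum>i\<le>length xs.
        b (Suc r - des (take i xs @ Suc r # drop i xs)) (des (take i xs @ Suc r # drop i xs)))"
    by (subst sum_permutations_of_set_insert [symmetric]) (auto simp: atLeastAtMostSuc_conv)
  also have "\<dots> = (\<Sum>xs\<in>permutations_of_set {1..r}. b' (r - des xs) (des xs))"
  proof (rule sum.cong [OF refl])
    fix xs
    assume "xs \<in> permutations_of_set {1..r}"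
    then have xs: "set xs = {1..r}" "length xs = r"
      by (auto simp: permutations_of_set_def dest: distinct_card)
    with des_le_length [of xs] have "Suc r - des xs = Suc (r - des xs)"
      by simp
    with xs show "(\<Sum>i\<le>length xs. b (Suc r - des (take i xs @ Suc r # drop i xs))
        (des (take i xs @ Suc r # drop i xs))) = b' (r - des xs) (des xs)"
      by (subst sum_des_insert [where f = "\<lambda>d. b (Suc r - d) d"]) (auto simp: b'_def)
  qed
  also have "\<dots> = (\<Sum>k\<le>r. fact k * real (Stirling r k) * b' k 0)"
    by (rule Suc.IH) (use rec in simp)
  also have "\<dots> = (\<Sum>k\<le>r. fact k * real (Stirling r k) * (real (Suc k) * b (Suc k) 0))
      + (\<Sum>k\<le>r. fact k * real (Stirling r k) * (real k * b k 0))"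
    unfolding sum.distrib [symmetric]
  proof (rule sum.cong [OF refl])
    fix k
    \<comment> \<open>On monomials the operator gives (k+1) x^(k+1) + k x^k. The recurrence is
      applied for k >= 1 only; at k = 0 the term in question has the factor k.\<close>
    have "b' k 0 = real (Suc k) * b (Suc k) 0 + real k * b k 0"
      using Suc.prems [of k 0] by (cases k) (auto simp: b'_def algebra_simps)
    then show "fact k * real (Stirling r k) * b' k 0 =
        fact k * real (Stirling r k) * (real (Suc k) * b (Suc k) 0)
        + fact k * real (Stirling r k) * (real k * b k 0)"
      by (simp add: algebra_simps)
  qed
  \<comment> \<open>The added top term vanishes since S(r,r+1) = 0. After the shift both sums carry
    \<open>b (Suc k) 0\<close>, and S(r+1,k+1) = (k+1) S(r,k+1) + S(r,k) merges them.\<close>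
  also have "(\<Sum>k\<le>r. fact k * real (Stirling r k) * (real k * b k 0)) =
      (\<Sum>k\<le>Suc r. fact k * real (Stirling r k) * (real k * b k 0))"
    by simp
  also have "\<dots> = (\<Sum>k\<le>r. fact (Suc k) * real (Stirling r (Suc k)) * (real (Suc k) * b (Suc k) 0))"
    by (subst sum.atMost_Suc_shift) simp
  also have "(\<Sum>k\<le>r. fact k * real (Stirling r k) * (real (Suc k) * b (Suc k) 0)) + \<dots> =
      (\<Sum>k\<le>Suc r. fact k * real (Stirling (Suc r) k) * b k 0)"
    unfolding sum.distrib [symmetric] sum.atMost_Suc_shift [of "\<lambda>k. fact k * real (Stirling (Suc r) k) * b k 0"]
    by (simp add: algebra_simps)
  finally show ?case .
qed

section \<open>One-line notation: from lists to permutations\<close>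

lemma bij_betw_permutes_lists:
  "bij_betw (\<lambda>p. map p [1..<Suc r]) {p. p permutes {1..r}} (permutations_of_set {1..r})"
proof -
  have inj: "inj_on (\<lambda>p. map p [1..<Suc r]) {p. p permutes {1..r}}"
  proof (rule inj_onI)
    fix p q :: "nat \<Rightarrow> nat"
    assume "p \<in> {p. p permutes {1..r}}" "q \<in> {p. p permutes {1..r}}"
      and *: "map p [1..<Suc r] = map q [1..<Suc r]"
    then have pq: "p permutes {1..r}" "q permutes {1..r}" by auto
    show "p = q"
    proof
      fix x
      show "p x = q x"
      proof (cases "x \<in> {1..r}")
        case True
        then have "x \<in> set [1..<Suc r]" by auto
        then show ?thesis using * by (metis map_eq_conv)
      next
        case False
        then show ?thesis using pq by (simp add: permutes_def)
      qed
    qed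
  qed
  have sub: "(\<lambda>p. map p [1..<Suc r]) ` {p. p permutes {1..r}} \<subseteq> permutations_of_set {1..r}"
  proof (rule image_subsetI)
    fix p
    assume "p \<in> {p. p permutes {1..r}}"
    then have p: "p permutes {1..r}" by simp
    show "map p [1..<Suc r] \<in> permutations_of_set {1..r}"
      using permutes_image [OF p] permutes_inj_on [OF p, of "{1..r}"]
      by (auto simp: permutations_of_set_def distinct_map atLeastLessThanSuc_atLeastAtMost simp del: upt_Suc)
  qed
  \<comment> \<open>Surjectivity by counting: both sets have r! elements.\<close>
  have "card ((\<lambda>p. map p [1..<Suc r]) ` {p. p permutes {1..r}}) = card (permutations_of_set {1..r})"
    unfolding card_image [OF inj] by (simp add: card_permutations)
  with inj sub show ?thesis
    by (auto simp: bij_betw_def card_subset_eq)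
qed

lemma card_descents: "card (descents r p) = des (map p [1..<Suc r])"
proof -
  have "descents r p = {i \<in> {0<..<r}. map p [1..<Suc r] ! (i - 1) > map p [1..<Suc r] ! i}"
    unfolding descents_def by (auto simp: nth_append simp del: upt_Suc)
  then show ?thesis by (simp add: des_conv_card del: upt_Suc)
qed

lemma sum_eulerian:
  fixes b :: "nat \<Rightarrow> nat \<Rightarrow> real"
  assumes "r \<ge> 1"
  shows "(\<Sum>l=1..r. real (eulerian r (r - l)) * b l (r - l)) =
    (\<Sum>xs\<in>permutations_of_set {1..r}. b (r - des xs) (des xs))"
proof -
  let ?P = "{p. p permutes {1..r}}"
  let ?d = "\<lambda>p. card (descents r p)"
  \<comment> \<open>This strict bound keeps l = r - j in 1..r, so that j and l determine each other
    despite truncated subtraction.\<close>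
  have lt: "?d p < r" for p
    using des_le_length [of "map p [1..<Suc r]"] assms by (simp add: card_descents del: upt_Suc)
  have "(\<Sum>xs\<in>permutations_of_set {1..r}. b (r - des xs) (des xs)) = (\<Sum>p\<in>?P. b (r - ?d p) (?d p))"
    unfolding card_descents
    by (rule sum.reindex_bij_betw [OF bij_betw_permutes_lists, symmetric])
  also have "\<dots> = (\<Sum>j<r. \<Sum>p | p \<in> ?P \<and> ?d p = j. b (r - ?d p) (?d p))"
    by (rule sum.group [symmetric]) (auto simp: finite_permutations lt)
  also have "\<dots> = (\<Sum>j<r. real (eulerian r j) * b (r - j) j)"
    by (rule sum.cong) (auto simp: eulerian_def)
  also have "\<dots> = (\<Sum>l=1..r. real (eulerian r (r - l)) * b l (r - l))"
    by (rule sum.reindex_bij_witness [where i = "\<lambda>l. r - l" and j = "\<lambda>j. r - j"]) auto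
  finally show ?thesis by simp
qed

text \<open>
  Linear form of Frobenius' identity \<open>\<Sum> A(r,r-l) x\<^sup>l (1+x)\<^sup>r\<^sup>-\<^sup>l = \<Sum> k! S(r,k) x\<^sup>k\<close>, where \<open>b l m\<close> is
  the value of a linear functional at \<open>x\<^sup>l (1+x)\<^sup>m\<close>.
\<close>
lemma sum_eulerian_conv_Stirling:
  fixes b :: "nat \<Rightarrow> nat \<Rightarrow> real"
  assumes "r \<ge> 1" "\<And>l m. l \<ge> 1 \<Longrightarrow> b l (Suc m) = b l m + b (Suc l) m"
  shows "(\<Sum>l=1..r. real (eulerian r (r - l)) * b l (r - l)) =
    (\<Sum>k=1..r. fact k * real (Stirling r k) * b k 0)"
proof -
  have "Stirling r 0 = 0"
    using assms(1) by (cases r) auto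
  then have "(\<Sum>k\<le>r. fact k * real (Stirling r k) * b k 0) =
      (\<Sum>k=1..r. fact k * real (Stirling r k) * b k 0)"
    by (intro sum.mono_neutral_right) (auto simp: not_le)
  with sum_permutations_des_conv_Stirling [of b r] sum_eulerian [of r b] assms show ?thesis
    by simp
qed

subsection \<open>Generating functions\<close>

text \<open>For e = exp(t) - 1, the derivative of e^k is k exp(t) e^(k-1) = k (e^k + e^(k-1)); on
  coefficients this is the Stirling recurrence.\<close>

lemma fps_exp_minus_1_power_nth:
  "fact n * fps_nth ((fps_exp (1::real) - 1) ^ k) n = fact k * real (Stirling n k)"
proof (induction n arbitrary: k)
  case 0
  then show ?case by (cases k) (auto simp: fps_nth_power_0)
next
  case (Suc n)
  show ?case
  proof (cases k)
    case 0
    then show ?thesis by simp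
  next
    case (Suc j)
    let ?e = "fps_exp (1::real) - 1"
    have "fps_deriv (?e ^ k) = fps_const (real k) * (fps_exp 1 * ?e ^ j)"
      unfolding fps_deriv_power by (simp add: Suc mult_ac)
    also have "fps_exp 1 * ?e ^ j = ?e ^ k + ?e ^ j"
      by (simp add: Suc algebra_simps)
    finally have "real (Suc n) * fps_nth (?e ^ k) (Suc n) =
        real k * (fps_nth (?e ^ k) n + fps_nth (?e ^ j) n)"
      by (metis fps_deriv_nth Suc_eq_plus1 fps_mult_left_const_nth fps_add_nth)
    then have "fact n * (real (Suc n) * fps_nth (?e ^ k) (Suc n)) =
        fact n * (real k * (fps_nth (?e ^ k) n + fps_nth (?e ^ j) n))"
      by (rule arg_cong)
    then have "fact (Suc n) * fps_nth (?e ^ k) (Suc n) =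
        real k * (fact n * fps_nth (?e ^ k) n + fact n * fps_nth (?e ^ j) n)"
      by (simp add: algebra_simps)
    then show ?thesis
      unfolding Suc.IH by (simp add: Suc algebra_simps)
  qed
qed

lemma fps_compose_one_minus_exp_nth:
  "fact r * fps_nth (Abs_fps c oo (1 - fps_exp (1::real))) r =
    (\<Sum>k\<le>r. (-1) ^ k * (fact k * real (Stirling r k)) * c k)"
proof -
  have "(1 - fps_exp (1::real)) ^ k = fps_const ((-1) ^ k) * (fps_exp 1 - 1) ^ k" for k
    by (metis fps_const_power fps_const_neg fps_const_1_eq_1 minus_diff_eq power_minus)
  then have "fact r * fps_nth (Abs_fps c oo (1 - fps_exp (1::real))) r =
      (\<Sum>k\<le>r. (-1) ^ k * (fact r * fps_nth ((fps_exp (1::real) - 1) ^ k) r) * c k)"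
    by (simp add: fps_compose_nth sum_distrib_left atMost_atLeast0 mult_ac)
  then show ?thesis
    by (simp add: fps_exp_minus_1_power_nth)
qed

section \<open>Bernoulli generating function: rescaling and parity\<close>

lemma fps_exp_minus_1_nonzero: "fps_exp (1::real) - 1 \<noteq> 0"
proof
  assume "fps_exp (1::real) - 1 = 0"
  then have "fps_nth (fps_exp (1::real) - 1) 1 = 0" by simp
  then show False by simp
qed

abbreviation bernoulli_egf :: "real fps" where
  "bernoulli_egf \<equiv> Abs_fps (\<lambda>n. bernoulli n / fact n)"

lemma bernoulli_egf_scaled:
  "Abs_fps (\<lambda>n. c ^ n * (bernoulli n / fact n)) * (fps_exp c - 1) = fps_const c * fps_X"
proof -
  have "(bernoulli_egf * (fps_exp 1 - 1)) oo (fps_const c * fps_X) = fps_X oo (fps_const c * fps_X)"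
    by (simp add: bernoulli_fps)
  then show ?thesis
    by (simp add: fps_compose_mult_distrib fps_compose_sub_distrib fps_compose_linear[of bernoulli_egf])
qed

text \<open>With B(t) = t/(e^t - 1) one has B(-t) = B(t) + t, so odd coefficients beyond the first
  vanish.\<close>

lemma bernoulli_odd:
  assumes "odd n" "n \<noteq> 1"
  shows "bernoulli n = 0"
proof -
  let ?B = "Abs_fps (\<lambda>n. (-1) ^ n * (bernoulli n / fact n))"
  have inv: "fps_exp (-1) * fps_exp (1::real) = 1"
    by (simp add: fps_exp_add_mult [symmetric])
  have "?B * (fps_exp 1 - 1) = - (?B * (fps_exp (-1) - 1)) * fps_exp 1"
    using inv by (simp add: algebra_simps)
  also have "\<dots> = fps_X * fps_exp 1"
    using bernoulli_egf_scaled [of "-1"] by (simp flip: fps_const_neg)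
  also have "\<dots> = (bernoulli_egf + fps_X) * (fps_exp 1 - 1)"
    unfolding distrib_right bernoulli_fps by (simp add: algebra_simps)
  finally have "?B = bernoulli_egf + fps_X"
    using fps_exp_minus_1_nonzero by simp
  then have "fps_nth ?B n = fps_nth (bernoulli_egf + fps_X) n"
    by simp
  with assms show ?thesis by simp
qed

lemma sum_Stirling_harmonic:
  assumes "r \<ge> 1"
  shows "(-1) ^ (r - 1) * bernoulli r =
    (\<Sum>k\<le>r. (-1) ^ k * (fact k * real (Stirling r k)) * (1 / (real k * real (k + 1))))"
proof -
  \<comment> \<open>Division by zero yields \<open>c 0 = 0\<close>, which gives K'(0) = 0
    below.\<close>
  define c where "c k = 1 / (real k * real (k + 1))" for k
  define u where "u = 1 - fps_exp (1::real)"
  define K where "K = fps_X * Abs_fps c"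
  have u0 [simp]: "fps_nth u 0 = 0" and du: "fps_deriv u = u - 1"
    by (simp_all add: u_def)
  have KS: "fps_nth K n = (if n = 0 then 0 else c (n - 1))" for n
    by (simp add: K_def)
  \<comment> \<open>The extra factor X in \<open>K\<close> lets two derivatives cancel k(k+1), so
    K'' = 1/(1-X). After composition 1 - X becomes -u', hence the derivative of K'(u) is
    constant.\<close>
  have ode: "(1 - fps_X) * fps_deriv (fps_deriv K) = 1"
  proof (rule fps_ext)
    fix n
    have dd: "fps_nth (fps_deriv (fps_deriv K)) m = 1" for m
      by (simp add: KS c_def field_simps del: of_nat_Suc)
    show "fps_nth ((1 - fps_X) * fps_deriv (fps_deriv K)) n = fps_nth 1 n"
      unfolding left_diff_distrib fps_sub_nth fps_X_mult_nth dd by (simp add: dd del: fps_deriv_nth)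
  qed
  \<comment> \<open>\<open>M\<close> is \<open>- ln (1 - u)\<close> at \<open>u = 1 - e\<^sup>t\<close>.\<close>
  define M where "M = fps_deriv K oo u"
  have "fps_deriv M = - (((1 - fps_X) * fps_deriv (fps_deriv K)) oo u)"
    unfolding M_def fps_compose_deriv [OF u0] du
    by (simp add: fps_compose_mult_distrib fps_compose_sub_distrib algebra_simps)
  then have "fps_deriv M = fps_deriv (- fps_X)"
    by (simp add: ode)
  moreover have "fps_nth M 0 = fps_nth (- fps_X) 0"
    by (simp add: M_def KS c_def)
  ultimately have M: "M = - fps_X"
    using fps_deriv_eq_iff by (metis cancel_comm_monoid_add_class.diff_cancel fps_const_0_eq_0 add_0)
  have "fps_deriv (K oo u) = fps_X * fps_exp 1"
    unfolding fps_compose_deriv [OF u0] M_def [symmetric] M by (simp add: u_def)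
  also have "\<dots> = fps_deriv (fps_X * fps_exp 1 - fps_exp 1 + 1)"
    by (simp add: algebra_simps)
  finally have "K oo u = fps_X * fps_exp 1 - fps_exp 1 + 1"
    unfolding fps_deriv_eq_iff by (simp add: KS)
  moreover have "K oo u = - ((Abs_fps c oo u) * (fps_exp 1 - 1))"
    unfolding K_def by (simp add: fps_compose_mult_distrib) (simp add: u_def algebra_simps)
  ultimately have "- ((Abs_fps c oo u) * (fps_exp 1 - 1)) = fps_X * fps_exp 1 - fps_exp 1 + 1"
    by (rule trans [OF sym, rotated])
  then have "(Abs_fps c oo u) * (fps_exp 1 - 1) = - (fps_X * fps_exp 1 - fps_exp 1 + 1)"
    by (rule minus_equation_iff [THEN iffD1, THEN sym])
  also have "\<dots> = fps_exp 1 - 1 - fps_X * fps_exp 1"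
    by simp
  also have "\<dots> = (1 - fps_X - bernoulli_egf) * (fps_exp 1 - 1)"
    unfolding left_diff_distrib bernoulli_fps by (simp add: algebra_simps)
  finally have "Abs_fps c oo u = 1 - fps_X - bernoulli_egf"
    using fps_exp_minus_1_nonzero by simp
  then have "(\<Sum>k\<le>r. (-1) ^ k * (fact k * real (Stirling r k)) * c k) =
      fact r * fps_nth (1 - fps_X - bernoulli_egf) r"
    unfolding u_def by (simp add: fps_compose_one_minus_exp_nth [symmetric])
  \<comment> \<open>For r >= 2 the coefficient gives -B_r: the sign fits even r, and odd r gives 0.
    For r = 1 it is -1 - B_1, equal to B_1 = -1/2.\<close>
  also have "\<dots> = (-1) ^ (r - 1) * bernoulli r"
  proof (cases "r = 1")
    case True
    have "fps_nth (bernoulli_egf * (fps_exp 1 - 1)) 2 = 0" "fps_nth (bernoulli_egf * (fps_exp 1 - 1)) 1 = 1"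
      by (simp_all add: bernoulli_fps)
    then have "bernoulli 1 = - 1 / 2"
      by (simp add: fps_mult_nth numeral_2_eq_2)
    with True show ?thesis by simp
  next
    case False
    with assms bernoulli_odd [of r] show ?thesis
      by (cases "odd r") auto
  qed
  finally show ?thesis by (simp add: c_def)
qed

text \<open>With B(t) = t/(e^t - 1), the generating function G = 2/(1 + e^(t/2)) satisfies t G = 4
  (B(t/2) - B(t)). The factor t accounts for the index r+1.\<close>

lemma sum_Stirling_catalan:
  assumes "r \<ge> 1"
  shows "(\<Sum>k\<le>r. (-1) ^ k * (fact k * real (Stirling r k)) *
      (fact (2 * k) / (fact k * fact (k + 1) * 4 ^ k))) =
    (-1) ^ r * 2 * (2 ^ (r + 1) - 1) / (2 ^ r * real (r + 1)) * bernoulli (r + 1)"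
proof -
  define c :: "nat \<Rightarrow> real" where "c k = fact (2 * k) / (fact k * fact (k + 1) * 4 ^ k)" for k
  define u where "u = 1 - fps_exp (1::real)"
  define K where "K = fps_X * Abs_fps c"
  define G where "G = Abs_fps c oo u"
  have u0 [simp]: "fps_nth u 0 = 0" and du: "fps_deriv u = u - 1"
    by (simp_all add: u_def)
  have c_Suc: "real (k + 2) * c (Suc k) = (real k + 1 / 2) * c k" for k
    by (simp add: c_def field_simps del: of_nat_Suc) (simp add: field_simps)
  have KS: "fps_nth K n = (if n = 0 then 0 else c (n - 1))" for n
    by (simp add: K_def)
  \<comment> \<open>\<open>c k\<close> is the Catalan number divided by \<open>4\<^sup>k\<close>, so \<open>K\<close> is \<open>2 (1 - sqrt (1 - X))\<close>.\<close>
  have ode: "(1 - fps_X) * fps_deriv K = 1 - fps_const (1 / 2) * K"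
  proof (rule fps_ext)
    fix n
    show "fps_nth ((1 - fps_X) * fps_deriv K) n = fps_nth (1 - fps_const (1 / 2) * K) n"
    proof (cases n)
      case 0
      then show ?thesis by (simp add: KS c_def)
    next
      case (Suc m)
      then show ?thesis using c_Suc [of m]
        by (simp add: left_diff_distrib KS algebra_simps)
    qed
  qed
  have "fps_deriv (K oo u) = - (((1 - fps_X) * fps_deriv K) oo u)"
    unfolding fps_compose_deriv [OF u0] du
    by (simp add: fps_compose_mult_distrib fps_compose_sub_distrib algebra_simps)
  then have ode': "fps_deriv (K oo u) = fps_const (1 / 2) * (K oo u) - 1"
    unfolding ode by (simp add: fps_compose_mult_distrib fps_compose_sub_distrib)
  \<comment> \<open>The constant solution 2 of y' = y/2 - 1 is subtracted to make the equation
    homogeneous.\<close>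
  define H where "H = (K oo u) - 2"
  have "fps_deriv H = fps_const (1 / 2) * H"
    unfolding H_def by (simp add: ode' numeral_fps_const algebra_simps)
  then have "H = fps_const (fps_nth H 0) * fps_exp (1 / 2)"
    by (simp add: fps_exp_unique_ODE)
  moreover have "fps_const (fps_nth H 0) = - 2"
    by (simp add: H_def KS neg_numeral_fps_const)
  ultimately have "K oo u = 2 - 2 * fps_exp (1 / 2)"
    by (simp add: H_def algebra_simps)
  moreover have "K oo u = - (G * (fps_exp 1 - 1))"
    unfolding K_def G_def by (simp add: fps_compose_mult_distrib) (simp add: u_def algebra_simps)
  ultimately have "- (G * (fps_exp 1 - 1)) = 2 - 2 * fps_exp (1 / 2)"
    by (rule trans [OF sym, rotated])
  then have "G * (fps_exp 1 - 1) = - (2 - 2 * fps_exp (1 / 2))"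
    by (rule minus_equation_iff [THEN iffD1, THEN sym])
  then have G: "G * (fps_exp 1 - 1) = 2 * (fps_exp (1 / 2) - 1)"
    by (simp add: algebra_simps)
  let ?B = "Abs_fps (\<lambda>n. (1 / 2) ^ n * (bernoulli n / fact n))"
  have sq: "fps_exp 1 = fps_exp (1 / 2) * fps_exp (1 / 2 :: real)"
    by (simp add: fps_exp_add_mult [symmetric])
  have half: "2 * fps_const (1 / 2) = (1 :: real fps)"
    by (simp add: numeral_fps_const)
  \<comment> \<open>Factoring e^t - 1 = (e^(t/2) - 1)(e^(t/2) + 1) brings B(t/2) and B(t) to a
    common denominator.\<close>
  have "4 * (?B - bernoulli_egf) * (fps_exp 1 - 1) =
      4 * (?B * (fps_exp (1 / 2) - 1)) * (fps_exp (1 / 2) + 1) - 4 * (bernoulli_egf * (fps_exp 1 - 1))"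
    unfolding sq by (simp add: algebra_simps)
  also have "\<dots> = 2 * (2 * fps_const (1 / 2)) * fps_X * (fps_exp (1 / 2) + 1) - 4 * fps_X"
    unfolding bernoulli_egf_scaled bernoulli_fps by (simp add: algebra_simps)
  also have "\<dots> = fps_X * G * (fps_exp 1 - 1)"
    unfolding half mult.assoc G by (simp add: algebra_simps)
  finally have XG: "fps_X * G = 4 * (?B - bernoulli_egf)"
    using fps_exp_minus_1_nonzero by simp
  have "fps_nth G r = fps_nth (fps_X * G) (Suc r)"
    by simp
  also have "\<dots> = 4 * ((1 / 2) ^ (r + 1) - 1) * bernoulli (r + 1) / fact (r + 1)"
    unfolding XG fps_mult_left_const_nth numeral_fps_const
    by (simp add: left_diff_distrib diff_divide_distrib del: fact_Suc)
  finally have "fact r * fps_nth G r = 4 * ((1 / 2) ^ (r + 1) - 1) / real (r + 1) * bernoulli (r + 1)"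
    by (simp add: fact_Suc del: of_nat_Suc)
  also have "4 * ((1 / 2) ^ (r + 1) - 1) = - 2 * (2 ^ (r + 1) - 1) / (2 ^ r :: real)"
    by (simp add: field_simps power_divide)
  \<comment> \<open>The signs agree for odd r; for even r the index r+1 is odd and at least 3, so
    both sides are 0.\<close>
  also have "- 2 * (2 ^ (r + 1) - 1) / 2 ^ r / real (r + 1) * bernoulli (r + 1) =
      (-1) ^ r * 2 * (2 ^ (r + 1) - 1) / (2 ^ r * real (r + 1)) * bernoulli (r + 1)"
    using assms bernoulli_odd [of "r + 1"] by (cases "even r") auto
  finally show ?thesis
    unfolding G_def u_def by (simp add: fps_compose_one_minus_exp_nth c_def)
qed

subsection \<open>The four identities\<close>

theorem theorem1:
  fixes r :: nat
  assumes "r \<ge> 1"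
  shows
    "bernoulli (r + 1) =
       (-1) ^ r * real (r + 1) * 2 ^ r / (2 ^ (r + 1) - 1) *
       (\<Sum>k=1..r. real (Stirling r k) / real (k + 1) * (-1) ^ k * (1 / 2 ^ (2 * k)) *
                  (fact (2 * k - 1) / fact (k - 1)))
   \<and> bernoulli (r + 1) =
       (-1) ^ r * real (r + 1) / (2 ^ r * (2 ^ (r + 1) - 1)) * real ((2 * r) choose (r - 1)) *
       (\<Sum>l=1..r. (-1) ^ l * real (eulerian r (r - l)) *
                  (real ((r - 1) choose (l - 1)) / real ((2 * r) choose (2 * l - 1))))
   \<and> (-1) ^ (r - 1) * bernoulli r =
       (\<Sum>k=1..r. (-1) ^ k * (real (Stirling r k) / real (k + 1)) * fact (k - 1))
   \<and> (-1) ^ (r - 1) * bernoulli r =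
       (\<Sum>l=1..r. real (eulerian r (r - l)) * ((-1) ^ l / (real l * real ((r + 1) choose l))))"
proof -
  \<comment> \<open>Beta integrals: \<open>b l m\<close> and \<open>d l m\<close> are the integrals of \<open>x\<^sup>l (1+x)\<^sup>m\<close> at \<open>x = -u\<close> over \<open>0 < u < 1\<close>
    against the weights \<open>(1-u)/u\<close> and \<open>sqrt ((1-u)/u) / pi\<close>.\<close>
  define b where "b l m = (-1) ^ l * (fact (l - 1) * fact (m + 1) / fact (l + m + 1) :: real)"
    for l m
  define d where "d l m = (-1) ^ l *
      (fact (2 * l) * fact (2 * m + 2) / (4 * 4 ^ (l + m) * fact l * fact (m + 1) * fact (l + m + 1)) :: real)"
    for l m
  \<comment> \<open>Over the common denominator (l+m+2)! the claim becomes m+2 = (l+m+2) -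
    l.\<close>
  have b_rec: "b l (Suc m) = b l m + b (Suc l) m" if l: "l \<ge> 1" for l m
  proof -
    obtain j where j: "l = Suc j" using l by (cases l) auto
    have "b l m = (-1) ^ l * fact j * fact (m + 1) / fact (l + m + 1)"
      by (simp add: b_def j)
    also have "\<dots> = (-1) ^ l * fact j * fact (m + 1) * real (l + m + 2) / fact (l + m + 2)"
      by (simp add: divide_simps) 
    finally have 1: "b l m = (-1) ^ l * fact j * fact (m + 1) * real (l + m + 2) / fact (l + m + 2)" .
    have 2: "b (Suc l) m = - ((-1) ^ l) * fact j * fact (m + 1) * real l / fact (l + m + 2)"
      by (simp add: b_def j)
    have 3: "b l (Suc m) = (-1) ^ l * fact j * fact (m + 1) * real (m + 2) / fact (l + m + 2)"
      by (simp add: b_def j)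
    show ?thesis
      unfolding 1 2 3 add_divide_distrib [symmetric] by (simp add: algebra_simps)
  qed
  have d_rec: "d l (Suc m) = d l m + d (Suc l) m" for l m
  proof -
    \<comment> \<open>\<open>q\<close> is the common factor of all three terms; what remains is
      (2m+3)/2 = (l+m+2) - (2l+1)/2.\<close>
    define q :: real where "q = (-1) ^ l * fact (2 * l) * fact (2 * m + 2) /
      (4 * 4 ^ (l + m) * fact l * fact (m + 1) * fact (l + m + 2))"
    have 1: "d l m = q * real (l + m + 2)"
      unfolding d_def q_def by (simp add: divide_simps)
    have 2: "d (Suc l) m = - q * real (2 * l + 1) / 2"
      unfolding d_def q_def by (simp add: divide_simps)
    have 3: "d l (Suc m) = q * real (2 * m + 3) / 2"
      unfolding d_def q_def by (simp add: divide_simps) (simp add: algebra_simps)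
    show ?thesis
      unfolding 1 2 3 by (simp add: field_simps)
  qed
  have drop0: "(\<Sum>k\<le>r. f k) = (\<Sum>k=1..r. f k)" if "f 0 = 0" for f :: "nat \<Rightarrow> real"
    using that by (intro sum.mono_neutral_right) (auto simp: not_le)
  have S0: "Stirling r 0 = 0"
    using assms by (cases r) auto

  have b0: "b k 0 = (-1) ^ k * (1 / (real k * real (k + 1)))" if "k \<ge> 1" for k
    using that by (cases k) (simp_all add: b_def)
  \<comment> \<open>This value of the functional \<open>b\<close> gives the third identity termwise
    and the fourth through the Eulerian expansion; \<open>catalan\<close> does the same for
    \<open>d\<close> and the first two.\<close>
  have harmonic: "(-1) ^ (r - 1) * bernoulli r = (\<Sum>k=1..r. fact k * real (Stirling r k) * b k 0)"
    unfolding sum_Stirling_harmonic [OF assms]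
    by (subst drop0) (auto simp: S0 b0 intro!: sum.cong)
  have three: "fact k * real (Stirling r k) * b k 0 =
      (-1) ^ k * (real (Stirling r k) / real (k + 1)) * fact (k - 1)" if "k \<ge> 1" for k
    using that by (cases k) (simp_all add: b0 divide_simps)
  have four: "b l (r - l) = (-1) ^ l / (real l * real ((r + 1) choose l))" if "l \<in> {1..r}" for l
  proof -
    have "real ((r + 1) choose l) = fact (r + 1) / (fact l * fact (r - l + 1))"
      using that by (subst binomial_fact) (simp_all add: Suc_diff_le del: fact_Suc)
    also have "fact l = (real l * fact (l - 1) :: real)"
      using that by (cases l) simp_all
    finally show ?thesis
      using that by (simp add: b_def del: fact_Suc)
  qed

  \<comment> \<open>The factor 1/2 is the total mass of the weight sqrt((1-u)/u)/pi.\<close>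
  have d0: "d k 0 = (-1) ^ k / 2 * (fact (2 * k) / (fact k * fact (k + 1) * 4 ^ k))" for k
    by (simp add: d_def numeral_2_eq_2)
  have catalan: "(-1) ^ r * (2 ^ (r + 1) - 1) / (2 ^ r * real (r + 1)) * bernoulli (r + 1) =
      (\<Sum>k=1..r. fact k * real (Stirling r k) * d k 0)"
  proof -
    have "(\<Sum>k=1..r. fact k * real (Stirling r k) * d k 0) =
      1 / 2 * (\<Sum>k=1..r. (-1) ^ k * (fact k * real (Stirling r k)) *
        (fact (2 * k) / (fact k * fact (k + 1) * 4 ^ k)))"
      by (simp add: sum_distrib_left d0 mult_ac del: fact_Suc)
    also have "\<dots> = (-1) ^ r * (2 ^ (r + 1) - 1) / (2 ^ r * real (r + 1)) * bernoulli (r + 1)"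
      by (subst drop0 [symmetric], simp add: S0, subst sum_Stirling_catalan [OF assms]) simp
    finally show ?thesis by simp
  qed
  have pos: "(2::real) ^ (r + 1) - 1 \<noteq> 0"
    using one_less_power [of "2 :: real" "r + 1"] by simp
  have "(-1) ^ r * real (r + 1) * 2 ^ r / (2 ^ (r + 1) - 1) *
      ((-1) ^ r * (2 ^ (r + 1) - 1) / (2 ^ r * real (r + 1)) * bernoulli (r + 1)) =
      ((-1) ^ r * (-1) ^ r) * bernoulli (r + 1)"
    using pos by (simp add: divide_simps del: of_nat_Suc power_Suc)
  also have "\<dots> = bernoulli (r + 1)"
    by (simp flip: power_mult_distrib)
  finally have bern: "bernoulli (r + 1) = (-1) ^ r * real (r + 1) * 2 ^ r / (2 ^ (r + 1) - 1) *
      (\<Sum>k=1..r. fact k * real (Stirling r k) * d k 0)"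
    unfolding catalan by simp
  have one: "fact k * real (Stirling r k) * d k 0 =
      real (Stirling r k) / real (k + 1) * (-1) ^ k * (1 / 2 ^ (2 * k)) *
        (fact (2 * k - 1) / fact (k - 1))" if "k \<ge> 1" for k
  proof -
    obtain j where "k = Suc j" using \<open>k \<ge> 1\<close> by (cases k) auto
    then show ?thesis
      by (simp add: d0 power_mult divide_simps)
  qed
  have two: "d l (r - l) = 1 / 4 ^ r * real ((2 * r) choose (r - 1)) *
      ((-1) ^ l * (real ((r - 1) choose (l - 1)) / real ((2 * r) choose (2 * l - 1))))"
    if "l \<in> {1..r}" for l
  proof -
    obtain j where j: "l = Suc j" using \<open>l \<in> {1..r}\<close> by (cases l) auto
    define m where "m = r - l"
    \<comment> \<open>Writing everything in \<open>j\<close> and \<open>m\<close> removes the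
      truncated subtractions from the binomials.\<close>
    have r: "r = Suc (j + m)" using that by (simp add: m_def j)
    have "real ((2 * r) choose (r - 1)) = fact (2 * r) / (fact (j + m) * fact (r + 1))"
      by (subst binomial_fact) (simp_all add: r add.commute del: fact_Suc)
    moreover have "real ((r - 1) choose (l - 1)) = fact (j + m) / (fact j * fact m)"
      by (subst binomial_fact) (simp_all add: r j)
    moreover have "real ((2 * r) choose (2 * l - 1)) = fact (2 * r) / (fact (2 * j + 1) * fact (2 * m + 1))"
      by (subst binomial_fact) (simp_all add: r j del: fact_Suc)
    ultimately have "1 / 4 ^ r * real ((2 * r) choose (r - 1)) *
      ((-1) ^ l * (real ((r - 1) choose (l - 1)) / real ((2 * r) choose (2 * l - 1)))) =
      (-1) ^ l / 4 ^ r * (fact (2 * j + 1) * fact (2 * m + 1)) / (fact (r + 1) * fact j * fact m)"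
      by (simp only:) (simp add: divide_simps del: fact_Suc)
    also have "\<dots> = d l m"
    proof -
      \<comment> \<open>The two factors 2 obtained here cancel the 4 in the denominator of
        \<open>d\<close>.\<close>
      have 1: "fact (2 * l) / fact l = (2 * (fact (2 * j + 1) / fact j) :: real)"
        by (simp add: j divide_simps)
      have 2: "fact (2 * m + 2) / fact (m + 1) = (2 * (fact (2 * m + 1) / fact m) :: real)"
        by (simp add: divide_simps)
      have 3: "l + m = r"
        by (simp add: r j)
      have "d l m = (-1) ^ l / (4 * 4 ^ r * fact (r + 1)) *
          (fact (2 * l) / fact l) * (fact (2 * m + 2) / fact (m + 1))"
        by (simp add: d_def 3 mult_ac del: fact_Suc)
      also have "\<dots> = (-1) ^ l / 4 ^ r * (fact (2 * j + 1) * fact (2 * m + 1)) / (fact (r + 1) * fact j * fact m)"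
        unfolding 1 2 by (simp del: fact_Suc)
      finally show ?thesis by simp
    qed
    finally show ?thesis by (simp add: m_def)
  qed

  show ?thesis
  proof (intro conjI)
    show "bernoulli (r + 1) =
       (-1) ^ r * real (r + 1) * 2 ^ r / (2 ^ (r + 1) - 1) *
       (\<Sum>k=1..r. real (Stirling r k) / real (k + 1) * (-1) ^ k * (1 / 2 ^ (2 * k)) *
                  (fact (2 * k - 1) / fact (k - 1)))"
      unfolding bern by (intro arg_cong2 [where f = "(*)"] refl sum.cong one) auto
    have "bernoulli (r + 1) = (-1) ^ r * real (r + 1) * 2 ^ r / (2 ^ (r + 1) - 1) *
      (\<Sum>l=1..r. real (eulerian r (r - l)) * d l (r - l))"
      unfolding bern by (subst sum_eulerian_conv_Stirling) (use assms d_rec in auto)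
    also have "(\<Sum>l=1..r. real (eulerian r (r - l)) * d l (r - l)) =
      1 / 4 ^ r * real ((2 * r) choose (r - 1)) * (\<Sum>l=1..r. (-1) ^ l * real (eulerian r (r - l)) *
                  (real ((r - 1) choose (l - 1)) / real ((2 * r) choose (2 * l - 1))))"
      unfolding sum_distrib_left by (intro sum.cong refl) (simp only: two, simp add: mult_ac)
    also have "(4::real) ^ r = 2 ^ r * 2 ^ r"
      by (simp flip: power_mult_distrib)
    finally show "bernoulli (r + 1) =
       (-1) ^ r * real (r + 1) / (2 ^ r * (2 ^ (r + 1) - 1)) * real ((2 * r) choose (r - 1)) *
       (\<Sum>l=1..r. (-1) ^ l * real (eulerian r (r - l)) *
                  (real ((r - 1) choose (l - 1)) / real ((2 * r) choose (2 * l - 1))))"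
      by (simp add: mult_ac)
    show "(-1) ^ (r - 1) * bernoulli r =
       (\<Sum>k=1..r. (-1) ^ k * (real (Stirling r k) / real (k + 1)) * fact (k - 1))"
      unfolding harmonic by (intro sum.cong refl three) auto
    have "(-1) ^ (r - 1) * bernoulli r = (\<Sum>l=1..r. real (eulerian r (r - l)) * b l (r - l))"
      unfolding harmonic by (subst sum_eulerian_conv_Stirling) (use assms b_rec in auto)
    also have "\<dots> = (\<Sum>l=1..r. real (eulerian r (r - l)) * ((-1) ^ l / (real l * real ((r + 1) choose l))))"
      by (intro sum.cong refl) (simp only: four)
    finally show "(-1) ^ (r - 1) * bernoulli r =
       (\<Sum>l=1..r. real (eulerian r (r - l)) * ((-1) ^ l / (real l * real ((r + 1) choose l))))" .
  qed
qed

end
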